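(* Let $I=\{1,\ldots,p\}$ and let $f_{i}:\mathbb{R}^n\to \mathbb{R}$ be directed subdifferentiable at $x\in \mathbb{R}^n$ for every $i \in I$. Then the pointwise maximum function $f:\mathbb{R}^n\to \mathbb{R}$, $f(\cdot) = \max_{i \in I} f_i(\cdot)$, is also directed subdifferentiable at $x$ and $$\overrightarrow{\partial} f(x) = \sup_{i\in I(x)}\{\overrightarrow{\partial} f_i(x)\},$$ where $I(x) = \{ i \in I\,|\, f(x) = f_i(x) \}$ is the set of active indices.
   Context: Notation. $\mathcal{S}_{n-1}$ is the Euclidean unit sphere in $\mathbb{R}^n$ (so $\mathcal{S}_0=\{-1,1\}$). The (Dini) directional derivative of $f:\mathbb{R}^n\to\mathbb{R}$ at $x$ in direction $l$ is $f'(x;l)=\lim_{t\downarrow 0}\frac{f(x+tl)-f(x)}{t}$. For $n\ge 2$ and $l\in\mathcal{S}_{n-1}$, $\Pi_{n-1,l}:\mathbb{R}^n\to\mathbb{R}^{n-1}$ is a fixed linear map that maps the orthogonal complement of $l$ isometrically onto $\mathbb{R}^{n-1}$ and maps $l$ to $0$; its transpose $\Pi_{n-1,l}^\top:\mathbb{R}^{n-1}\to\mathbb{R}^n$ maps $\mathbb{R}^{n-1}$ onto the orthogonal complement of $l$ and inverts the restriction of $\Pi_{n-1,l}$ to that complement. Directed subdifferentiable functions. A function $f:\mathbb{R}\to\mathbb{R}$ is $M$-directed subdifferentiable at $x\in\mathbb{R}$ if $f'(x;1)$ and $f'(x;-1)$ exist and $\max\{|f'(x;-1)|,|f'(x;1)|\}\le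 M$. A function $f:\mathbb{R}^n\to\mathbb{R}$, $n\ge2$, is $M$-directed subdifferentiable at $x\in\mathbb{R}^n$ if $f'(x;l)$ exists for every $l$, is continuous as a function of $l$, satisfies $\max_{l\in\mathcal{S}_{n-1}}|f'(x;l)|\le M$, and for every $l\in\mathcal{S}_{n-1}$ the function $f_l:\mathbb{R}^{n-1}\to\mathbb{R}$, $f_l(\cdot)=f'(x;l+\Pi_{n-1,l}^\top(\cdot))$, is $M$-directed subdifferentiable at $0_{n-1}$. $f$ is directed subdifferentiable at $x$ if it is $M$-directed subdifferentiable at $x$ for some $M\ge 0$. Directed sets. For $n=1$ a directed set is a directed interval $\overrightarrow{[a,b]}$ with $a,b\in\mathbb{R}$ arbitrary, identified with the pair $(a_1(-1),a_1(1))=(-a,b)$; its norm is $\max\{|a_1(-1)|,|a_1(1)|\}$. For $n\ge2$ a directed set is a family $\overrightarrow{A}=(\overrightarrow{A_{n-1}(l)},a_n(l))_{l\in\mathcal{S}_{n-1}}$ with $a_n:\mathcal{S}_{n-1}\to\mathbb{R}$ continuous and $l\mapsto\overrightarrow{A_{n-1}(l)}$ a map into $(n-1)$-dimensional directed sets, uniformly bounded in norm; its norm is $\max\{\sup_l\|\overrightarrow{A_{n-1}(l)}\|,\max_l|a_n(l)|\}$. Supremum of finitely many directed sets (finite nonempty index set $I$). For $n=1$ and $\overrightarrow{A_i}=\overrightarrow{[\alpha_i^-,\alpha_i^+]}$: $\sup_{i\in I}\{\overrightarrow{A_i}\}=\overrightarrow{[\min_{i\in I}\alpha_i^-,\max_{i\in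 I}\alpha_i^+]}$. For $n\ge2$ and $\overrightarrow{A^i_n}=(\overrightarrow{A^i_{n-1}(l)},a^i_n(l))_{l\in\mathcal{S}_{n-1}}$: $\sup_{i\in I}\{\overrightarrow{A^i_n}\}=\big(\sup_{i\in I(l)}\{\overrightarrow{A^i_{n-1}(l)}\},\max_{i\in I}a^i_n(l)\big)_{l\in\mathcal{S}_{n-1}}$, where $I(l)=\{i\in I\,|\,a^i_n(l)=\max_{k\in I}a^k_n(l)\}$. Directed subdifferential. For $f$ directed subdifferentiable at $x$: if $n=1$, $\overrightarrow{\partial} f(x)=\overrightarrow{[-f'(x;-1),f'(x;1)]}=(f'(x;l))_{l=\pm1}$; if $n\ge2$, $\overrightarrow{\partial} f(x)=(\overrightarrow{\partial} f_l(0),f'(x;l))_{l\in\mathcal{S}_{n-1}}$ with $f_l(\cdot)=f'(x;l+\Pi_{n-1,l}^\top(\cdot))$. *)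

theory Defs
  imports "HOL-Analysis.Analysis"
begin

text \<open>
  The definitions recurse on the dimension, so \<open>\<real>\<^sup>n\<close> is the library's
  \<^term>\<open>Euclidean_space n\<close>: sequences vanishing from index \<open>n\<close> on. The unit sphere of
  \<open>\<real>\<^sup>n\<close> is then \<^term>\<open>topspace (nsphere (n - 1))\<close>. The real line is \<open>\<real>\<^sup>1\<close>, with its
  two unit vectors \<open>unit1\<close> and \<open>neg_unit1\<close> in the role of \<open>1\<close> and \<open>-1\<close>.
\<close>

type_synonym rvec = "nat \<Rightarrow> real"

definition unit1 :: rvec where
  "unit1 = (\<lambda>i. if i = 0 then 1 else 0)"

definition neg_unit1 :: rvec where
  "neg_unit1 = (\<lambda>i. if i = 0 then - 1 else 0)"

definition has_dir_deriv :: "(rvec \<Rightarrow> real) \<Rightarrow> rvec \<Rightarrow> rvec \<Rightarrow> real \<Rightarrow> bool" where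
  "has_dir_deriv f x l d \<longleftrightarrow> ((\<lambda>t. (f (\<lambda>i. x i + t * l i) - f x) / t) \<longlongrightarrow> d) (at_right 0)"

definition dir_deriv :: "(rvec \<Rightarrow> real) \<Rightarrow> rvec \<Rightarrow> rvec \<Rightarrow> real" where
  "dir_deriv f x l = Lim (at_right 0) (\<lambda>t. (f (\<lambda>i. x i + t * l i) - f x) / t)"

definition mat_apply :: "nat \<Rightarrow> nat \<Rightarrow> (nat \<Rightarrow> nat \<Rightarrow> real) \<Rightarrow> rvec \<Rightarrow> rvec" where
  "mat_apply k n A x = (\<lambda>i. if i < k then (\<Sum>j<n. A i j * x j) else 0)"

definition mat_transpose :: "(nat \<Rightarrow> nat \<Rightarrow> real) \<Rightarrow> nat \<Rightarrow> nat \<Rightarrow> real" where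
  "mat_transpose A = (\<lambda>i j. A j i)"

definition orth_compl :: "nat \<Rightarrow> rvec \<Rightarrow> rvec set" where
  "orth_compl n l = {v \<in> topspace (Euclidean_space n). (\<Sum>j<n. l j * v j) = 0}"

text \<open>
  \<open>P k l\<close> is the \<open>k \<times> (k + 1)\<close> matrix of \<open>\<Pi>\<^bsub>k,l\<^esub> : \<real>\<^bsup>k+1\<^esup> \<rightarrow> \<real>\<^sup>k\<close> in the standard bases;
  entries outside this range are never read.
\<close>

definition projection_family :: "(nat \<Rightarrow> rvec \<Rightarrow> nat \<Rightarrow> nat \<Rightarrow> real) \<Rightarrow> bool" where
  "projection_family P \<longleftrightarrow> (\<forall>k\<ge>1. \<forall>l\<in>topspace (nsphere k).
     let T = mat_apply k (Suc k) (P k l); C = orth_compl (Suc k) l in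
       T ` C = topspace (Euclidean_space k) \<and>
       (\<forall>u\<in>C. \<forall>v\<in>C. L2_set (\<lambda>i. T u i - T v i) {..<k} = L2_set (\<lambda>i. u i - v i) {..<Suc k}) \<and>
       T l = (\<lambda>_. 0))"

text \<open>\<open>sliced_deriv P k f x l\<close> is \<open>f\<^sub>l = f'(x; l + \<Pi>\<^bsub>k,l\<^esub>\<^sup>T (\<cdot>))\<close> on \<open>\<real>\<^sup>k\<close>, for \<open>f\<close> on \<open>\<real>\<^bsup>k+1\<^esup>\<close>.\<close>

definition sliced_deriv ::
  "(nat \<Rightarrow> rvec \<Rightarrow> nat \<Rightarrow> nat \<Rightarrow> real) \<Rightarrow> nat \<Rightarrow> (rvec \<Rightarrow> real) \<Rightarrow> rvec \<Rightarrow> rvec \<Rightarrow> rvec \<Rightarrow> real" where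
  "sliced_deriv P k f x l =
     (\<lambda>y. dir_deriv f x (\<lambda>i. l i + mat_apply (Suc k) k (mat_transpose (P k l)) y i))"

text \<open>Dimension 0 plays no role here or below; its equations are dummies.\<close>

fun M_directed_subdifferentiable ::
  "(nat \<Rightarrow> rvec \<Rightarrow> nat \<Rightarrow> nat \<Rightarrow> real) \<Rightarrow> nat \<Rightarrow> real \<Rightarrow> (rvec \<Rightarrow> real) \<Rightarrow> rvec \<Rightarrow> bool" where
  "M_directed_subdifferentiable P 0 M f x \<longleftrightarrow> False"
| "M_directed_subdifferentiable P (Suc 0) M f x \<longleftrightarrow>
     (\<exists>d. has_dir_deriv f x unit1 d) \<and> (\<exists>d. has_dir_deriv f x neg_unit1 d) \<and>
     max \<bar>dir_deriv f x neg_unit1\<bar> \<bar>dir_deriv f x unit1\<bar> \<le> M"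
| "M_directed_subdifferentiable P (Suc (Suc m)) M f x \<longleftrightarrow>
     (\<forall>l\<in>topspace (Euclidean_space (Suc (Suc m))). \<exists>d. has_dir_deriv f x l d) \<and>
     continuous_map (Euclidean_space (Suc (Suc m))) euclideanreal (\<lambda>l. dir_deriv f x l) \<and>
     (\<forall>l\<in>topspace (nsphere (Suc m)). \<bar>dir_deriv f x l\<bar> \<le> M) \<and>
     (\<forall>l\<in>topspace (nsphere (Suc m)).
        M_directed_subdifferentiable P (Suc m) M (sliced_deriv P (Suc m) f x l) (\<lambda>_. 0))"

definition directed_subdifferentiable ::
  "(nat \<Rightarrow> rvec \<Rightarrow> nat \<Rightarrow> nat \<Rightarrow> real) \<Rightarrow> nat \<Rightarrow> (rvec \<Rightarrow> real) \<Rightarrow> rvec \<Rightarrow> bool" where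
  "directed_subdifferentiable P n f x \<longleftrightarrow> (\<exists>M\<ge>0. M_directed_subdifferentiable P n M f x)"

text \<open>
  \<open>DInterval a b\<close> is the directed interval with arbitrary real end points \<open>a\<close>, \<open>b\<close>.
  A family indexed by the sphere is a function extensional on the sphere, so that equality of
  directed sets is equality in HOL.
\<close>

datatype dset =
    DInterval (lower: real) (upper: real)
  | DFamily (family: "rvec \<Rightarrow> dset \<times> real")

fun dnorm :: "nat \<Rightarrow> dset \<Rightarrow> real" where
  "dnorm 0 A = 0"
| "dnorm (Suc 0) A = max \<bar>- lower A\<bar> \<bar>upper A\<bar>"
| "dnorm (Suc (Suc m)) A =
     max (SUP l\<in>topspace (nsphere (Suc m)). dnorm (Suc m) (fst (family A l)))
         (SUP l\<in>topspace (nsphere (Suc m)). \<bar>snd (family A l)\<bar>)"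

fun directed_sets :: "nat \<Rightarrow> dset set" where
  "directed_sets 0 = {}"
| "directed_sets (Suc 0) = {DInterval a b | a b. True}"
| "directed_sets (Suc (Suc m)) = {DFamily F | F.
     F \<in> extensional (topspace (nsphere (Suc m))) \<and>
     continuous_map (nsphere (Suc m)) euclideanreal (\<lambda>l. snd (F l)) \<and>
     (\<forall>l\<in>topspace (nsphere (Suc m)). fst (F l) \<in> directed_sets (Suc m)) \<and>
     bdd_above ((\<lambda>l. dnorm (Suc m) (fst (F l))) ` topspace (nsphere (Suc m)))}"

text \<open>\<open>dsup n I A\<close> is the supremum of the \<open>n\<close>-dimensional directed sets \<open>A i\<close>, \<open>i \<in> I\<close>,
  for a finite nonempty index set \<open>I\<close>.\<close>

fun dsup :: "nat \<Rightarrow> 'i set \<Rightarrow> ('i \<Rightarrow> dset) \<Rightarrow> dset" where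
  "dsup 0 I A = DInterval 0 0"
| "dsup (Suc 0) I A = DInterval (Min ((\<lambda>i. lower (A i)) ` I)) (Max ((\<lambda>i. upper (A i)) ` I))"
| "dsup (Suc (Suc m)) I A = DFamily (\<lambda>l\<in>topspace (nsphere (Suc m)).
     (dsup (Suc m)
        {i \<in> I. snd (family (A i) l) = Max ((\<lambda>k. snd (family (A k) l)) ` I)}
        (\<lambda>i. fst (family (A i) l)),
      Max ((\<lambda>i. snd (family (A i) l)) ` I)))"

fun directed_subdifferential ::
  "(nat \<Rightarrow> rvec \<Rightarrow> nat \<Rightarrow> nat \<Rightarrow> real) \<Rightarrow> nat \<Rightarrow> (rvec \<Rightarrow> real) \<Rightarrow> rvec \<Rightarrow> dset" where
  "directed_subdifferential P 0 f x = DInterval 0 0"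
| "directed_subdifferential P (Suc 0) f x =
     DInterval (- dir_deriv f x neg_unit1) (dir_deriv f x unit1)"
| "directed_subdifferential P (Suc (Suc m)) f x = DFamily (\<lambda>l\<in>topspace (nsphere (Suc m)).
     (directed_subdifferential P (Suc m) (sliced_deriv P (Suc m) f x l) (\<lambda>_. 0),
      dir_deriv f x l))"

lemma topspace_nsphere_ne: "topspace (nsphere k) \<noteq> {}"
  by (metis in_topspace_nsphere empty_iff)

lemma continuous_map_nsphere_of_Euclidean:
  assumes "continuous_map (Euclidean_space (Suc k)) X g"
  shows "continuous_map (nsphere k) X g"
  using assms unfolding nsphere_def by (rule continuous_map_from_subtopology)

lemma compact_space_nsphere: "compact_space (nsphere k)"
proof -
  let ?T = "powertop_real UNIV"
  let ?B = "Pi\<^sub>E UNIV (\<lambda>i. if i \<le> k then {-1..1} else {0::real})"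
  let ?Q = "{x \<in> topspace ?T. (\<Sum>i\<le>k. (x i)\<^sup>2) \<in> {1}}"
  have "compactin ?T ?B"
    by (auto simp: compactin_PiE)
  moreover have "closedin ?T ?Q"
  proof (rule closedin_continuous_map_preimage)
    show "continuous_map ?T euclideanreal (\<lambda>x. \<Sum>i\<le>k. (x i)\<^sup>2)"
      by (intro continuous_map_sum continuous_map_real_pow continuous_map_product_projection) auto
  qed auto
  ultimately have "compactin ?T (?B \<inter> ?Q)"
    by (rule compact_Int_closedin)
  moreover have "?B \<inter> ?Q = {x. (\<Sum>i\<le>k. (x i)\<^sup>2) = 1 \<and> (\<forall>i>k. x i = 0)}" (is "_ = ?S")
  proof (intro equalityI subsetI)
    fix x assume x: "x \<in> ?S"
    have "x i \<in> {-1..1}" if "i \<le> k" for i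
    proof -
      have "(x i)\<^sup>2 \<le> (\<Sum>i\<le>k. (x i)\<^sup>2)"
        using that by (intro member_le_sum) auto
      then have "(x i)\<^sup>2 \<le> 1" using x by simp
      then show ?thesis by (simp add: abs_square_le_1 abs_le_iff)
    qed
    then show "x \<in> ?B \<inter> ?Q" using x by auto
  next
    fix x assume x: "x \<in> ?B \<inter> ?Q"
    have "x i = 0" if "i > k" for i
      using x that by (auto dest!: PiE_mem[of _ _ _ i] split: if_splits)
    then show "x \<in> ?S" using x by auto
  qed
  ultimately show ?thesis
    by (simp add: nsphere compact_space_subtopology)
qed

lemma bdd_above_abs_nsphere:
  assumes "continuous_map (nsphere k) euclideanreal g"
  shows "bdd_above ((\<lambda>l. \<bar>g l\<bar>) ` topspace (nsphere k))"
proof -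
  have "compactin euclideanreal (g ` topspace (nsphere k))"
    using compact_space_nsphere assms unfolding compact_space_def by (rule image_compactin)
  then have "bounded (g ` topspace (nsphere k))"
    by (simp add: compact_imp_bounded)
  then show ?thesis
    by (auto simp: bounded_iff bdd_above_def)
qed

lemma continuous_map_Max:
  assumes "finite I" "I \<noteq> {}" "\<And>i. i \<in> I \<Longrightarrow> continuous_map X euclideanreal (g i)"
  shows "continuous_map X euclideanreal (\<lambda>x. Max ((\<lambda>i. g i x) ` I))"
  using assms
proof (induction I rule: finite_ne_induct)
  case (singleton i)
  then show ?case by simp
next
  case (insert i I)
  then show ?case
    by (simp add: continuous_map_real_max)
qed

lemma directed_subdifferential_in_directed_sets:
  assumes "M_directed_subdifferentiable P n M f x"
  shows "directed_subdifferential P n f x \<in> directed_sets n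
         \<and> dnorm n (directed_subdifferential P n f x) \<le> M"
  using assms
proof (induction P n M f x rule: M_directed_subdifferentiable.induct)
  case (1 P M f x)
  then show ?case by simp
next
  case (2 P M f x)
  then show ?case by auto
next
  case (3 P m M f x)
  let ?S = "topspace (nsphere (Suc m))"
  let ?D = "\<lambda>l. directed_subdifferential P (Suc m) (sliced_deriv P (Suc m) f x l) (\<lambda>_. 0)"
  have D: "?D l \<in> directed_sets (Suc m)" "dnorm (Suc m) (?D l) \<le> M" if "l \<in> ?S" for l
    using 3 that by auto
  have c: "continuous_map (nsphere (Suc m)) euclideanreal (\<lambda>l. dir_deriv f x l)"
    using 3 by (auto intro: continuous_map_nsphere_of_Euclidean)
  have "continuous_map (nsphere (Suc m)) euclideanreal
      (\<lambda>l. snd ((\<lambda>l\<in>?S. (?D l, dir_deriv f x l)) l))"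
    by (rule continuous_map_eq[OF c]) simp
  moreover have "bdd_above ((\<lambda>l. dnorm (Suc m)
      (fst ((\<lambda>l\<in>?S. (?D l, dir_deriv f x l)) l))) ` ?S)"
    using D by (auto intro!: bdd_aboveI2[where M = M])
  moreover have "(SUP l\<in>?S. dnorm (Suc m) (?D l)) \<le> M"
    using D by (intro cSUP_least topspace_nsphere_ne) auto
  moreover have "(SUP l\<in>?S. \<bar>dir_deriv f x l\<bar>) \<le> M"
    using 3 by (intro cSUP_least topspace_nsphere_ne) auto
  ultimately show ?case
    using D by (auto cong: image_cong_simp)
qed

lemma dsup_in_directed_sets:
  assumes "n \<ge> 1" "finite I" "I \<noteq> {}" "\<And>i. i \<in> I \<Longrightarrow> A i \<in> directed_sets n"
    and "\<And>i. i \<in> I \<Longrightarrow> dnorm n (A i) \<le> K"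
  shows "dsup n I A \<in> directed_sets n \<and> dnorm n (dsup n I A) \<le> K"
  using assms
proof (induction n I A rule: dsup.induct)
  case (1 I A)
  then show ?case by simp
next
  case (2 I A)
  have "Min ((\<lambda>i. lower (A i)) ` I) \<in> (\<lambda>i. lower (A i)) ` I"
    "Max ((\<lambda>i. upper (A i)) ` I) \<in> (\<lambda>i. upper (A i)) ` I"
    using 2 by simp_all
  then show ?case using 2(5) by fastforce
next
  case (3 m I A)
  let ?S = "topspace (nsphere (Suc m))"
  let ?a = "\<lambda>i l. snd (family (A i) l)"
  let ?B = "\<lambda>i l. fst (family (A i) l)"
  let ?mx = "\<lambda>l. Max ((\<lambda>i. ?a i l) ` I)"
  let ?J = "\<lambda>l. {i \<in> I. ?a i l = ?mx l}"
  let ?D = "\<lambda>l. dsup (Suc m) (?J l) (\<lambda>i. ?B i l)"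
  have ca: "continuous_map (nsphere (Suc m)) euclideanreal (?a i)" if "i \<in> I" for i
    using 3(5)[OF that] by auto
  have B: "?B i l \<in> directed_sets (Suc m)" if "i \<in> I" "l \<in> ?S" for i l
    using 3(5)[OF that(1)] that(2) by auto
  have bB: "bdd_above ((\<lambda>l. dnorm (Suc m) (?B i l)) ` ?S)" if "i \<in> I" for i
    using 3(5)[OF that] by auto
  have nB: "dnorm (Suc m) (?B i l) \<le> K" if "i \<in> I" "l \<in> ?S" for i l
    using 3(6)[OF that(1)] cSUP_upper[OF that(2) bB[OF that(1)]] by simp
  have na: "\<bar>?a i l\<bar> \<le> K" if "i \<in> I" "l \<in> ?S" for i l
    using 3(6)[OF that(1)]
      cSUP_upper[OF that(2) bdd_above_abs_nsphere[OF ca[OF that(1)]]] by simp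
  have mxin: "?mx l \<in> (\<lambda>i. ?a i l) ` I" for l
    using 3(3,4) by simp
  have Jne: "?J l \<noteq> {}" for l
    using mxin[of l] by force
  have D: "?D l \<in> directed_sets (Suc m) \<and> dnorm (Suc m) (?D l) \<le> K" if "l \<in> ?S" for l
    using 3(3) Jne[of l] B[OF _ that] nB[OF _ that] that by (intro 3(1)) auto
  have c: "continuous_map (nsphere (Suc m)) euclideanreal ?mx"
    using 3(3,4) ca by (rule continuous_map_Max)
  have "continuous_map (nsphere (Suc m)) euclideanreal (\<lambda>l. snd ((\<lambda>l\<in>?S. (?D l, ?mx l)) l))"
    by (rule continuous_map_eq[OF c]) simp
  moreover have "bdd_above ((\<lambda>l. dnorm (Suc m) (fst ((\<lambda>l\<in>?S. (?D l, ?mx l)) l))) ` ?S)"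
    using D by (auto intro!: bdd_aboveI2[where M = K])
  moreover have "(SUP l\<in>?S. dnorm (Suc m) (?D l)) \<le> K"
    using D by (intro cSUP_least topspace_nsphere_ne) auto
  moreover have "(SUP l\<in>?S. \<bar>?mx l\<bar>) \<le> K"
  proof (intro cSUP_least topspace_nsphere_ne)
    fix l assume "l \<in> ?S"
    then show "\<bar>?mx l\<bar> \<le> K" using mxin[of l] na by auto
  qed
  ultimately show ?case
    using D by (auto cong: image_cong_simp)
qed

lemma projection_family_exists: "\<exists>P. projection_family P"
proof
  define P :: "nat \<Rightarrow> rvec \<Rightarrow> nat \<Rightarrow> nat \<Rightarrow> real" where
    "P k l i j = (if i = j then 1 else 0) - l i * (l j - (if j = k then 1 else 0)) / (1 - l k)"
    for k l i j
  have "T ` C = topspace (Euclidean_space k) \<and>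
       (\<forall>u\<in>C. \<forall>v\<in>C. L2_set (\<lambda>i. T u i - T v i) {..<k} = L2_set (\<lambda>i. u i - v i) {..<Suc k}) \<and>
       T l = (\<lambda>_. 0)"
    if k: "k \<ge> 1" and l: "l \<in> topspace (nsphere k)"
      and T: "T = mat_apply k (Suc k) (P k l)" and C: "C = orth_compl (Suc k) l" for k l T C
  proof -
    define c where "c = 1 / (1 - l k)"
    have "(\<Sum>i\<le>k. (l i)\<^sup>2) = 1"
      using l by (simp add: nsphere)
    then have s: "(\<Sum>i<k. l i * l i) = 1 - l k * l k"
      by (simp add: lessThan_Suc_atMost[symmetric] power2_eq_square)
    have l1: "l i = 0" if "l k = 1" "i < k" for i
      using s that by (simp add: sum_nonneg_eq_0_iff)
    have app: "T v i = v i - c * l i * ((\<Sum>j<k. l j * v j) - (1 - l k) * v k)" if "i < k" for v i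
    proof -
      have "(\<Sum>j<k. P k l i j * v j) = (\<Sum>j<k. (if i = j then v j else 0) - c * l i * (l j * v j))"
        by (intro sum.cong) (auto simp: P_def c_def algebra_simps)
      also have "\<dots> = v i - c * l i * (\<Sum>j<k. l j * v j)"
        using that by (simp add: sum_subtractf sum_distrib_left)
      finally show ?thesis
        using that by (simp add: T mat_apply_def P_def c_def algebra_simps diff_divide_distrib)
    qed
    have out: "T v i = 0" if "\<not> i < k" for v i
      using that by (simp add: T mat_apply_def)
    have cl: "c * l i * (1 - l k) = l i" if "i < k" for i
      using l1[OF _ that] by (cases "l k = 1") (auto simp: c_def)
    have inC: "T v i = v i + c * l i * v k" if "(\<Sum>j<Suc k. l j * v j) = 0" "i < k" for v i
    proof -
      have "(\<Sum>j<k. l j * v j) = - l k * v k" using that by simp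
      then show ?thesis using app[OF that(2), of v] by (simp add: algebra_simps)
    qed
    have "T l i = 0" for i
    proof (cases "i < k")
      case True
      have "T l i = l i - c * l i * (1 - l k)"
        using app[OF True, of l] s by (simp add: algebra_simps)
      then show ?thesis using cl[OF True] by simp
    qed (simp add: out)
    then have 1: "T l = (\<lambda>_. 0)" by auto
    have 2: "L2_set (\<lambda>i. T u i - T v i) {..<k} = L2_set (\<lambda>i. u i - v i) {..<Suc k}"
      if "u \<in> C" "v \<in> C" for u v
    proof -
      define w where "w = (\<lambda>i. u i - v i)"
      have lu: "(\<Sum>j<Suc k. l j * u j) = 0" and lv: "(\<Sum>j<Suc k. l j * v j) = 0"
        using that by (auto simp: C orth_compl_def)
      have "(\<Sum>j<Suc k. l j * w j) = (\<Sum>j<Suc k. l j * u j) - (\<Sum>j<Suc k. l j * v j)"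
        unfolding w_def sum_subtractf[symmetric] by (simp add: right_diff_distrib)
      then have lw: "(\<Sum>j<k. l j * w j) = - l k * w k"
        using lu lv by simp
      have "(\<Sum>i<k. (T u i - T v i)\<^sup>2) = (\<Sum>i<k. (w i + c * w k * l i)\<^sup>2)"
        using inC[OF lu] inC[OF lv] by (intro sum.cong) (auto simp: w_def algebra_simps)
      also have "\<dots> = (\<Sum>i<k. (w i)\<^sup>2 + 2 * c * w k * (l i * w i) + (c * w k)\<^sup>2 * (l i * l i))"
        by (intro sum.cong) (auto simp: power2_eq_square algebra_simps)
      also have "\<dots> = (\<Sum>i<k. (w i)\<^sup>2) + 2 * c * w k * (- l k * w k) + (c * w k)\<^sup>2 * (1 - l k * l k)"
        by (simp add: sum.distrib sum_distrib_left[symmetric] lw s)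
      also have "\<dots> = (\<Sum>i<k. (w i)\<^sup>2) + (w k)\<^sup>2"
      proof (cases "l k = 1")
        case True
        then have "w k = 0" using lw l1 by simp
        then show ?thesis by simp
      next
        case False
        then have c1: "c * (1 - l k) = 1" by (simp add: c_def)
        have "2 * c * w k * (- l k * w k) + (c * w k)\<^sup>2 * (1 - l k * l k)
            = (w k)\<^sup>2 * (c * (c * (1 - l k)) * (1 + l k) - 2 * c * l k)"
          by (simp add: power2_eq_square algebra_simps)
        also have "\<dots> = (w k)\<^sup>2 * (c * (1 - l k))"
          by (subst c1) (simp add: algebra_simps)
        finally show ?thesis by (simp add: c1)
      qed
      finally show ?thesis by (simp add: L2_set_def w_def)
    qed
    have 3: "y \<in> T ` C" if y: "y \<in> topspace (Euclidean_space k)" for y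
    proof -
      define b where "b = (\<Sum>i<k. l i * y i)"
      define v where "v = (\<lambda>j. if j < k then y j - c * b * l j else if j = k then b else 0)"
      have b0: "b = 0" if "l k = 1" using l1[OF that] by (simp add: b_def)
      have "(\<Sum>j<k. l j * v j) = (\<Sum>j<k. l j * y j - c * b * (l j * l j))"
        by (intro sum.cong) (auto simp: v_def algebra_simps)
      also have "\<dots> = b - c * b * (1 - l k * l k)"
        by (simp add: sum_subtractf sum_distrib_left[symmetric] s b_def)
      also have "\<dots> = - l k * b"
      proof (cases "l k = 1")
        case False
        then have c1: "c * (1 - l k) = 1" by (simp add: c_def)
        have "b - c * b * (1 - l k * l k) = b - (c * (1 - l k)) * b * (1 + l k)"
          by (simp add: algebra_simps)
        then show ?thesis unfolding c1 by (simp add: algebra_simps)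
      qed (simp add: b0)
      finally have lv: "(\<Sum>j<Suc k. l j * v j) = 0" by (simp add: v_def)
      then have "v \<in> C" by (auto simp: C orth_compl_def topspace_Euclidean_space v_def)
      moreover have "T v i = y i" for i
      proof (cases "i < k")
        case True
        then show ?thesis using inC[OF lv True] by (simp add: v_def)
      next
        case False
        then show ?thesis using y out by (simp add: topspace_Euclidean_space)
      qed
      ultimately show ?thesis by (metis ext image_eqI)
    qed
    have 4: "T v \<in> topspace (Euclidean_space k)" for v
      by (simp add: topspace_Euclidean_space out)
    show ?thesis using 1 2 3 4 by blast
  qed
  then show "projection_family P"
    by (auto simp: projection_family_def Let_def)
qed

end

theory Submission
  imports Defs
begin

text \<open>
  A function with a directional derivative at \<open>x\<close> is continuous along the corresponding ray, so
  inactive functions stay strictly below the maximum near \<open>x\<close> and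
  \<open>F'(x;l) = max\<^bsub>i\<in>I(x)\<^esub> f\<^sub>i'(x;l)\<close>. Hence the slice of \<open>F\<close> is again a pointwise maximum, of
  the slices of the active \<open>f\<^sub>i\<close>, and its active indices at 0 are those \<open>i\<close> at which
  \<open>f\<^sub>i'(x;l)\<close> is maximal. This is the recursion defining the supremum of directed sets, and
  induction on the dimension applies.
\<close>

lemma tendsto_Max_image:
  fixes g :: "'i \<Rightarrow> 'a \<Rightarrow> 'b::linorder_topology"
  assumes "finite I" "I \<noteq> {}" "\<And>i. i \<in> I \<Longrightarrow> (g i \<longlongrightarrow> d i) X"
  shows "((\<lambda>t. Max ((\<lambda>i. g i t) ` I)) \<longlongrightarrow> Max (d ` I)) X"
  using assms
proof (induction I rule: finite_ne_induct)
  case (insert i I)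
  then show ?case by (simp add: tendsto_max)
qed simp

lemma dir_deriv_eqI: "has_dir_deriv f x l d \<Longrightarrow> dir_deriv f x l = d"
  unfolding has_dir_deriv_def dir_deriv_def by (rule tendsto_Lim) simp

text \<open>For \<open>t > 0\<close> the value on the ray is \<open>f x\<close> plus
  \<open>t\<close> times the difference quotient. The quotient converges, so this product tends to
  \<open>0 * d\<close>.\<close>

lemma has_dir_deriv_tendsto_ray:
  assumes "has_dir_deriv f x l d"
  shows "((\<lambda>t. f (\<lambda>i. x i + t * l i)) \<longlongrightarrow> f x) (at_right 0)"
proof -
  have "((\<lambda>t. f x + t * ((f (\<lambda>i. x i + t * l i) - f x) / t)) \<longlongrightarrow> f x + 0 * d) (at_right 0)"
    using assms unfolding has_dir_deriv_def by (intro tendsto_intros)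
  moreover have "\<forall>\<^sub>F t in at_right (0::real).
      f x + t * ((f (\<lambda>i. x i + t * l i) - f x) / t) = f (\<lambda>i. x i + t * l i)"
    unfolding eventually_at_right_field by (intro exI[of _ 1]) auto
  ultimately show ?thesis
    using tendsto_cong by fastforce
qed

lemma active_indices_ne:
  assumes "finite I" "I \<noteq> {}" "c = Max (g ` I)"
  shows "{i \<in> I. c = g i} \<noteq> {}"
proof -
  have "c \<in> g ` I" unfolding assms(3) using assms(1,2) by (intro Max_in) auto
  then show ?thesis by auto
qed

text \<open>For small \<open>t > 0\<close> the difference quotient of \<open>F\<close> is the
  maximum of the quotients of the active functions, and limits pass through finite maxima. The
  formula for \<open>F\<close> is assumed only on \<open>Euclidean_space n\<close>, which contains
  the whole ray.\<close>

lemma has_dir_deriv_Max: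
  assumes "finite I" "I \<noteq> {}"
    and x: "x \<in> topspace (Euclidean_space n)" and l: "l \<in> topspace (Euclidean_space n)"
    and F: "\<And>y. y \<in> topspace (Euclidean_space n) \<Longrightarrow> F y = Max ((\<lambda>i. f i y) ` I)"
    and d: "\<And>i. i \<in> I \<Longrightarrow> has_dir_deriv (f i) x l (d i)"
  shows "has_dir_deriv F x l (Max (d ` {i \<in> I. F x = f i x}))"
proof -
  define J where "J = {i \<in> I. F x = f i x}"
  define r where "r = (\<lambda>t i. x i + t * l i)"
  have J: "finite J" "J \<subseteq> I" and "J \<noteq> {}"
    using assms(1) active_indices_ne[OF assms(1,2) F[OF x]] by (auto simp: J_def)
  \<comment> \<open>A single active index to compare with: once \<open>f j\<close> exceeds every
    inactive function, the maximum over \<open>I\<close> is attained on \<open>J\<close>.\<close>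
  then obtain j where j: "j \<in> J" by auto
  have "\<forall>\<^sub>F t in at_right 0. f i (r t) < f j (r t)" if i: "i \<in> I - J" for i
  proof -
    have "f i x \<le> F x" using i assms(1) by (simp add: F[OF x])
    then have "f i x < f j x" using i j by (auto simp: J_def)
    moreover have "((\<lambda>t. f k (r t)) \<longlongrightarrow> f k x) (at_right 0)" if "k \<in> I" for k
      unfolding r_def using has_dir_deriv_tendsto_ray d that by blast
    then have "((\<lambda>t. f j (r t) - f i (r t)) \<longlongrightarrow> f j x - f i x) (at_right 0)"
      using i j J by (intro tendsto_diff) auto
    ultimately show ?thesis
      using order_tendstoD(1)[of _ "f j x - f i x" _ 0] by fastforce
  qed
  then have "\<forall>\<^sub>F t in at_right 0. \<forall>i\<in>I - J. f i (r t) < f j (r t)"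
    using assms(1) by (simp add: eventually_ball_finite)
  moreover have "\<forall>\<^sub>F t in at_right (0::real). t > 0"
    by (rule eventually_at_right_less)
  ultimately have "\<forall>\<^sub>F t in at_right 0.
      Max ((\<lambda>i. (f i (r t) - f i x) / t) ` J) = (F (r t) - F x) / t"
  proof eventually_elim
    case (elim t)
    have "r t \<in> topspace (Euclidean_space n)"
      using x l by (simp add: topspace_Euclidean_space r_def)
    then have "F (r t) = Max ((\<lambda>i. f i (r t)) ` I)" by (rule F)
    also have "\<dots> = Max ((\<lambda>i. f i (r t)) ` J)"
    proof (rule Max_eq_if)
      show "\<forall>a\<in>(\<lambda>i. f i (r t)) ` I. \<exists>b\<in>(\<lambda>i. f i (r t)) ` J. a \<le> b"
        using elim(1) j by (auto intro: less_imp_le)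
      show "\<forall>b\<in>(\<lambda>i. f i (r t)) ` J. \<exists>a\<in>(\<lambda>i. f i (r t)) ` I. b \<le> a"
        using J by auto
    qed (use assms(1) J in auto)
    finally have Ft: "F (r t) = Max ((\<lambda>i. f i (r t)) ` J)" .
    \<comment> \<open>Subtracting \<open>F x\<close> and dividing by \<open>t > 0\<close> is
      monotone, hence commutes with \<open>Max\<close>. On \<open>J\<close> the constant
      \<open>F x\<close> may then be replaced by \<open>f i x\<close>.\<close>
    have "mono (\<lambda>y. (y - F x) / t)"
      using elim(2) by (auto simp: mono_def divide_right_mono)
    then have "(F (r t) - F x) / t = Max ((\<lambda>y. (y - F x) / t) ` (\<lambda>i. f i (r t)) ` J)"
      unfolding Ft using J \<open>J \<noteq> {}\<close> by (intro mono_Max_commute) auto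
    also have "(\<lambda>y. (y - F x) / t) ` (\<lambda>i. f i (r t)) ` J = (\<lambda>i. (f i (r t) - f i x) / t) ` J"
      unfolding image_image by (rule image_cong) (auto simp: J_def)
    finally show ?case by simp
  qed
  moreover have "((\<lambda>t. Max ((\<lambda>i. (f i (r t) - f i x) / t) ` J)) \<longlongrightarrow> Max (d ` J)) (at_right 0)"
    using d J \<open>J \<noteq> {}\<close> unfolding has_dir_deriv_def r_def by (intro tendsto_Max_image) auto
  ultimately have "((\<lambda>t. (F (r t) - F x) / t) \<longlongrightarrow> Max (d ` J)) (at_right 0)"
    using tendsto_cong by fast
  then show ?thesis by (simp add: has_dir_deriv_def r_def J_def)
qed

lemma dir_deriv_Max:
  assumes "finite I" "I \<noteq> {}"
    and "x \<in> topspace (Euclidean_space n)" "l \<in> topspace (Euclidean_space n)"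
    and "\<And>y. y \<in> topspace (Euclidean_space n) \<Longrightarrow> F y = Max ((\<lambda>i. f i y) ` I)"
    and d: "\<And>i. i \<in> I \<Longrightarrow> \<exists>d. has_dir_deriv (f i) x l d"
  shows "\<exists>d. has_dir_deriv F x l d"
    and "dir_deriv F x l = Max ((\<lambda>i. dir_deriv (f i) x l) ` {i \<in> I. F x = f i x})"
proof -
  have "has_dir_deriv (f i) x l (dir_deriv (f i) x l)" if "i \<in> I" for i
    using d[OF that] dir_deriv_eqI by blast
  with assms have *: "has_dir_deriv F x l
      (Max ((\<lambda>i. dir_deriv (f i) x l) ` {i \<in> I. F x = f i x}))"
    by (intro has_dir_deriv_Max[where n = n])
  then show "\<exists>d. has_dir_deriv F x l d" by blast
  from * show "dir_deriv F x l = Max ((\<lambda>i. dir_deriv (f i) x l) ` {i \<in> I. F x = f i x})"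
    by (rule dir_deriv_eqI)
qed

lemma abs_Max_image_le:
  fixes g :: "'i \<Rightarrow> 'a::linordered_idom"
  assumes "finite I" "I \<noteq> {}" "\<And>i. i \<in> I \<Longrightarrow> \<bar>g i\<bar> \<le> M"
  shows "\<bar>Max (g ` I)\<bar> \<le> M"
proof -
  have "Max (g ` I) \<in> g ` I" using assms(1,2) by (intro Max_in) auto
  then show ?thesis using assms(3) by auto
qed

lemma nsphere_subset_Euclidean: "topspace (nsphere k) \<subseteq> topspace (Euclidean_space (Suc k))"
  by (auto simp: nsphere_def)

text \<open>A matrix sends 0 to 0. This identifies the indices active for the slices at the origin
  with the set \<open>I(l)\<close> in the supremum of directed sets.\<close>

lemma sliced_deriv_zero: "sliced_deriv P k f x l (\<lambda>_. 0) = dir_deriv f x l"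
  by (simp add: sliced_deriv_def mat_apply_def cong: if_cong)

text \<open>Lets finitely many functions with different bounds share one.\<close>

lemma M_directed_subdifferentiable_mono:
  "M_directed_subdifferentiable P n M f x \<Longrightarrow> M \<le> M' \<Longrightarrow> M_directed_subdifferentiable P n M' f x"
  by (induction P n M f x rule: M_directed_subdifferentiable.induct) force+

text \<open>\<open>I\<close> and \<open>f\<close> are generalized in the induction because the step
  passes to the active set \<open>J\<close> and to the slices of the \<open>f i\<close>. The common
  bound \<open>M\<close> survives, since a maximum of numbers in \<open>[-M, M]\<close> stays
  there.\<close>

lemma M_directed_subdifferentiable_Max:
  assumes "finite I" "I \<noteq> {}"
    and "x \<in> topspace (Euclidean_space n)"
    and "\<And>i. i \<in> I \<Longrightarrow> M_directed_subdifferentiable P n M (f i) x"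
    and "\<And>y. y \<in> topspace (Euclidean_space n) \<Longrightarrow> F y = Max ((\<lambda>i. f i y) ` I)"
  shows "M_directed_subdifferentiable P n M F x \<and>
         directed_subdifferential P n F x =
           dsup n {i \<in> I. F x = f i x} (\<lambda>i. directed_subdifferential P n (f i) x)"
  using assms
proof (induction P n M F x arbitrary: I f rule: M_directed_subdifferentiable.induct)
  case (1 P M F x)
  then show ?case by auto
next
  case (2 P M F x)
  define J where "J = {i \<in> I. F x = f i x}"
  have J: "finite J" "J \<noteq> {}" "J \<subseteq> I"
    using 2(1) active_indices_ne[OF 2(1,2) 2(5)[OF 2(3)]] by (auto simp: J_def)
  have u: "unit1 \<in> topspace (Euclidean_space (Suc 0))"
    "neg_unit1 \<in> topspace (Euclidean_space (Suc 0))"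
    by (auto simp: topspace_Euclidean_space unit1_def neg_unit1_def)
  note D = dir_deriv_Max[where F = F and f = f, OF 2(1-3) _ 2(5), folded J_def]
  have pos: "\<exists>d. has_dir_deriv F x unit1 d"
    "dir_deriv F x unit1 = Max ((\<lambda>i. dir_deriv (f i) x unit1) ` J)"
    by (rule D[OF u(1)]; use 2(4) in simp)+
  have neg: "\<exists>d. has_dir_deriv F x neg_unit1 d"
    "dir_deriv F x neg_unit1 = Max ((\<lambda>i. dir_deriv (f i) x neg_unit1) ` J)"
    by (rule D[OF u(2)]; use 2(4) in simp)+
  have "\<bar>dir_deriv F x unit1\<bar> \<le> M" "\<bar>dir_deriv F x neg_unit1\<bar> \<le> M"
    unfolding pos(2) neg(2) using J 2(4) by (auto intro!: abs_Max_image_le)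
  \<comment> \<open>The lower end point is a negated derivative, so the maximum turns into the
    minimum required by \<open>dsup\<close>.\<close>
  moreover have "- dir_deriv F x neg_unit1 = Min ((\<lambda>i. - dir_deriv (f i) x neg_unit1) ` J)"
    unfolding neg(2) using J by (subst minus_Max_eq_Min) (auto simp: image_image)
  ultimately show ?case using pos neg by (simp flip: J_def)
next
  case (3 P m M F x)
  let ?S = "topspace (nsphere (Suc m))"
  let ?E = "topspace (Euclidean_space (Suc (Suc m)))"
  define J where "J = {i \<in> I. F x = f i x}"
  have J: "finite J" "J \<noteq> {}" "J \<subseteq> I"
    using 3(2) active_indices_ne[OF 3(2,3) 3(6)[OF 3(4)]] by (auto simp: J_def)
  have fi: "\<exists>d. has_dir_deriv (f i) x l d" if "i \<in> I" "l \<in> ?E" for i l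
    using 3(5) that by auto
  note D = dir_deriv_Max[where F = F and f = f, OF 3(2-4) _ 3(6), folded J_def]
  have ex: "\<exists>d. has_dir_deriv F x l d"
    and eq: "dir_deriv F x l = Max ((\<lambda>i. dir_deriv (f i) x l) ` J)" if "l \<in> ?E" for l
    using fi that D[OF that] by blast+
  have SE: "l \<in> ?E" if "l \<in> ?S" for l
    using that nsphere_subset_Euclidean by blast
  have "continuous_map (Euclidean_space (Suc (Suc m))) euclideanreal
      (\<lambda>l. Max ((\<lambda>i. dir_deriv (f i) x l) ` J))"
    using J 3(5) by (intro continuous_map_Max) auto
  then have c: "continuous_map (Euclidean_space (Suc (Suc m))) euclideanreal (dir_deriv F x)"
    by (rule continuous_map_eq) (simp add: eq)
  have le: "\<bar>dir_deriv F x l\<bar> \<le> M" if "l \<in> ?S" for l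
    unfolding eq[OF SE[OF that]] using J 3(5) that by (intro abs_Max_image_le) auto
  have slice: "M_directed_subdifferentiable P (Suc m) M (sliced_deriv P (Suc m) F x l) (\<lambda>_. 0) \<and>
      directed_subdifferential P (Suc m) (sliced_deriv P (Suc m) F x l) (\<lambda>_. 0) =
        dsup (Suc m) {i \<in> J. dir_deriv F x l = dir_deriv (f i) x l}
          (\<lambda>i. directed_subdifferential P (Suc m) (sliced_deriv P (Suc m) (f i) x l) (\<lambda>_. 0))"
    if "l \<in> ?S" for l
  proof -
    have "M_directed_subdifferentiable P (Suc m) M (sliced_deriv P (Suc m) F x l) (\<lambda>_. 0) \<and>
      directed_subdifferential P (Suc m) (sliced_deriv P (Suc m) F x l) (\<lambda>_. 0) =
        dsup (Suc m) {i \<in> J. sliced_deriv P (Suc m) F x l (\<lambda>_. 0) =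
            sliced_deriv P (Suc m) (f i) x l (\<lambda>_. 0)}
          (\<lambda>i. directed_subdifferential P (Suc m) (sliced_deriv P (Suc m) (f i) x l) (\<lambda>_. 0))"
    \<comment> \<open>The induction hypothesis is applied to \<open>J\<close>, not \<open>I\<close>:
      by \<open>eq\<close>, the slice of \<open>F\<close> is the maximum of the slices over
      \<open>J\<close> alone.\<close>
    proof (rule 3(1)[OF that J(1,2)])
      fix y assume "y \<in> topspace (Euclidean_space (Suc m))"
      have "(\<lambda>i. l i + mat_apply (Suc (Suc m)) (Suc m) (mat_transpose (P (Suc m) l)) y i) \<in> ?E"
        using SE[OF that] by (simp add: topspace_Euclidean_space mat_apply_def)
      then show "sliced_deriv P (Suc m) F x l y = Max ((\<lambda>i. sliced_deriv P (Suc m) (f i) x l y) ` J)"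
        unfolding sliced_deriv_def by (rule eq)
    qed (use J 3(5) that in \<open>auto simp: topspace_Euclidean_space\<close>)
    then show ?thesis by (simp only: sliced_deriv_zero)
  qed
  \<comment> \<open>By \<open>eq\<close>, the maximum in \<open>dsup\<close> is
    \<open>dir_deriv F x l\<close>, so its index set at \<open>l\<close> is the one in
    \<open>slice\<close> up to the orientation of the equation.\<close>
  have "directed_subdifferential P (Suc (Suc m)) F x =
      dsup (Suc (Suc m)) J (\<lambda>i. directed_subdifferential P (Suc (Suc m)) (f i) x)"
    using slice eq[OF SE] by (auto intro!: restrict_ext simp: eq_commute)
  then show ?case using ex c le slice by (simp flip: J_def)
qed

theorem proposition2p10:
  fixes n p :: nat
    and P :: "nat \<Rightarrow> (nat \<Rightarrow> real) \<Rightarrow> nat \<Rightarrow> nat \<Rightarrow> real"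
    and f :: "nat \<Rightarrow> (nat \<Rightarrow> real) \<Rightarrow> real"
    and F :: "(nat \<Rightarrow> real) \<Rightarrow> real"
    and x :: "nat \<Rightarrow> real"
  assumes "n \<ge> 1" and "p \<ge> 1"
    and "projection_family P"
    and "x \<in> topspace (Euclidean_space n)"
    and "\<And>i. i \<in> {1..p} \<Longrightarrow> directed_subdifferentiable P n (f i) x"
    and "\<And>y. y \<in> topspace (Euclidean_space n) \<Longrightarrow> F y = Max ((\<lambda>i. f i y) ` {1..p})"
  shows "directed_subdifferentiable P n F x \<and>
         directed_subdifferential P n F x =
           dsup n {i \<in> {1..p}. F x = f i x} (\<lambda>i. directed_subdifferential P n (f i) x)"
proof -
  obtain M where M: "\<And>i. i \<in> {1..p} \<Longrightarrow> M i \<ge> 0 \<and> M_directed_subdifferentiable P n (M i) (f i) x"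
    using assms(5) unfolding directed_subdifferentiable_def by metis
  \<comment> \<open>The bounds are nonnegative, so their sum dominates each of them and serves as
    the common bound.\<close>
  have le: "M i \<le> (\<Sum>i=1..p. M i)" if "i \<in> {1..p}" for i
    using that M by (intro member_le_sum) auto
  have "M_directed_subdifferentiable P n (\<Sum>i=1..p. M i) F x \<and>
         directed_subdifferential P n F x =
           dsup n {i \<in> {1..p}. F x = f i x} (\<lambda>i. directed_subdifferential P n (f i) x)"
    using assms(2,4,6) M le
    by (intro M_directed_subdifferentiable_Max) (auto intro: M_directed_subdifferentiable_mono)
  moreover have "(\<Sum>i=1..p. M i) \<ge> 0"
    using M by (intro sum_nonneg) auto
  ultimately show ?thesis
    unfolding directed_subdifferentiable_def by blast
qed

end
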